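(* Let $a\in\mathbb R$ with $a\ne0$ and let $q$ be a non-degenerate quadratic form over $\mathbb R$ of signature $(r_+,r_-)$. Then $$\omega(\mathcal G_{q,a})=\begin{cases}r_++1,&\text{if }a>0,\\ r_-+1,&\text{if }a<0.\end{cases}$$
   Context: The form $q$ is on a finite-dimensional real vector space $V$. The signature $(r_+,r_-)$ records the numbers of positive and negative entries in a diagonalization of $q$. $\mathcal G_{q,a}$ is the graph with vertex set $V$ and edge set $\{\{x,y\}\mid x\ne y,\ q(x-y)=a\}$; $\omega$ denotes the clique number (size of a largest clique). *)

theory Defs
  imports "HOL-Analysis.Analysis" "HOL-Library.Ramsey" "HOL-Library.Extended_Nat"
begin

definition finite_dimensional :: "'v::real_vector itself \<Rightarrow> bool" where
  "finite_dimensional _ \<longleftrightarrow> (\<exists>B :: 'v set. finite B \<and> span B = UNIV)"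

definition polar :: "('v::real_vector \<Rightarrow> real) \<Rightarrow> 'v \<Rightarrow> 'v \<Rightarrow> real" where
  "polar q x y = q (x + y) - q x - q y"

definition quadratic_form :: "('v::real_vector \<Rightarrow> real) \<Rightarrow> bool" where
  "quadratic_form q \<longleftrightarrow>
     (\<forall>c x. q (c *\<^sub>R x) = c\<^sup>2 * q x) \<and> bilinear (polar q)"

definition nondegenerate :: "('v::real_vector \<Rightarrow> real) \<Rightarrow> bool" where
  "nondegenerate q \<longleftrightarrow> (\<forall>x. (\<forall>y. polar q x y = 0) \<longrightarrow> x = 0)"

text \<open>\<open>B\<close> is a basis in whose coordinates the form is \<open>\<Sum>b. d b * (x b)\<^sup>2\<close>;
  the diagonal entries are the values \<open>d b\<close> for \<open>b \<in> B\<close>.\<close>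

definition diagonalization ::
  "('v::real_vector \<Rightarrow> real) \<Rightarrow> 'v set \<Rightarrow> ('v \<Rightarrow> real) \<Rightarrow> bool" where
  "diagonalization q B d \<longleftrightarrow>
     finite B \<and> independent B \<and> span B = UNIV \<and>
     (\<forall>x :: 'v \<Rightarrow> real. q (\<Sum>b\<in>B. x b *\<^sub>R b) = (\<Sum>b\<in>B. d b * (x b)\<^sup>2))"

text \<open>A relation rather than a function, so that no appeal to Sylvester's law of inertia is
  needed for it to be meaningful: any diagonalization may witness it.\<close>

definition has_signature :: "('v::real_vector \<Rightarrow> real) \<Rightarrow> nat \<times> nat \<Rightarrow> bool" where
  "has_signature q s \<longleftrightarrow>
     (\<exists>B d. diagonalization q B d \<and>
        s = (card {b \<in> B. d b > 0}, card {b \<in> B. d b < 0}))"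

definition form_graph_edges :: "('v::real_vector \<Rightarrow> real) \<Rightarrow> real \<Rightarrow> 'v set set" where
  "form_graph_edges q a = {{x, y} | x y. x \<noteq> y \<and> q (x - y) = a}"

text \<open>The supremum of the sizes of finite cliques in \<open>enat\<close>. A finite value is attained by
  a largest clique, while an infinite clique, or finite cliques of unbounded size, give
  \<open>\<infinity>\<close>.\<close>

definition clique_number :: "'a set \<Rightarrow> 'a set set \<Rightarrow> enat" where
  "clique_number V E = (SUP K \<in> {K. K \<subseteq> V \<and> finite K \<and> clique K E}. enat (card K))"

end

(* Translate a clique so that one vertex is 0. The other vertices u then satisfy q u = a and
   polar q u v = a for u \<noteq> v, so q (\<Sum>u. c u *\<^sub>R u) = a / 2 * ((\<Sum>u. (c u)\<^sup>2) + (\<Sum>u. c u)\<^sup>2). For a > 0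
   these vertices are thus independent of each other and of the diagonalizing vectors b with
   d b \<le> 0, on whose span q \<le> 0; counting dimensions leaves at most r_plus of them. Conversely,
   rescaling the b with d b > 0 makes q a multiple of the Euclidean form on their span, where
   the unit vectors and a suitable multiple of their sum form a regular simplex. The case a < 0
   follows by passing to -q. *)
theory Submission
  imports Defs
begin

section \<open>Quadratic forms and their polar forms\<close>

lemma bilinear_sum_same:
  assumes "bilinear B"
  shows "B (\<Sum>u\<in>U. c u *\<^sub>R u) (\<Sum>v\<in>U. c v *\<^sub>R v) = (\<Sum>u\<in>U. \<Sum>v\<in>U. c u * c v * (B u v :: real))"
proof -
  have "B (\<Sum>u\<in>U. c u *\<^sub>R u) (\<Sum>v\<in>U. c v *\<^sub>R v)
      = (\<Sum>(u, v)\<in>U \<times> U. B (c u *\<^sub>R u) (c v *\<^sub>R v))"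
    by (rule bilinear_sum[OF assms])
  then show ?thesis
    by (simp add: sum.cartesian_product bilinear_lmul[OF assms] bilinear_rmul[OF assms]
        mult.assoc mult.left_commute)
qed

lemma quadratic_form_zero: "quadratic_form q \<Longrightarrow> q 0 = 0"
  unfolding quadratic_form_def by (metis mult_zero_left scale_zero_left zero_power2)

lemma quadratic_form_polar_self:
  assumes "quadratic_form q"
  shows "polar q x x = 2 * q x"
proof -
  have "q (2 *\<^sub>R x) = 2\<^sup>2 * q x"
    using assms unfolding quadratic_form_def by blast
  then show ?thesis by (simp add: polar_def scaleR_2)
qed

lemma quadratic_form_minus: "quadratic_form q \<Longrightarrow> q (- x) = q x"
  unfolding quadratic_form_def
  by (metis mult_1 power2_minus power_one scaleR_minus1_left)

lemma quadratic_form_diff: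
  assumes "quadratic_form q"
  shows "q (x - y) = q x + q y - polar q x y"
proof -
  have "polar q x (- y) = - polar q x y"
    using assms bilinear_rneg unfolding quadratic_form_def by blast
  then show ?thesis
    using quadratic_form_minus[OF assms, of y] by (simp add: polar_def)
qed

lemma quadratic_form_diff_commute:
  "quadratic_form q \<Longrightarrow> q (x - y) = q (y - x)"
  by (metis minus_diff_eq quadratic_form_minus)

section \<open>Cliques as regular simplices\<close>

lemma clique_form_graph_iff:
  assumes "quadratic_form q"
  shows "clique K (form_graph_edges q a) \<longleftrightarrow> (\<forall>x\<in>K. \<forall>y\<in>K. x \<noteq> y \<longrightarrow> q (x - y) = a)"
proof -
  \<comment> \<open>An edge fixes its endpoints only up to order; evenness of \<open>q\<close> makes
    the condition independent of that order.\<close>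
  have "{x, y} \<in> form_graph_edges q a \<longleftrightarrow> x \<noteq> y \<and> q (x - y) = a" for x y
    unfolding form_graph_edges_def
    using quadratic_form_diff_commute[OF assms, of x y] by (auto simp: doubleton_eq_iff)
  then show ?thesis unfolding clique_def by auto
qed

text \<open>Together with 0 the set \<open>U\<close> is a regular simplex, so its Gram matrix for
  \<open>polar q\<close> is \<open>a\<close> times the sum of the identity and the all-ones matrix.
  These two summands give the two squares. For \<open>a > 0\<close> the value is positive unless all
  coefficients vanish.\<close>

lemma quadratic_form_simplex:
  assumes q: "quadratic_form q" and "finite U"
    and vertex: "\<And>u. u \<in> U \<Longrightarrow> q u = a"
    and edge: "\<And>u v. u \<in> U \<Longrightarrow> v \<in> U \<Longrightarrow> u \<noteq> v \<Longrightarrow> q (u - v) = a"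
  shows "q (\<Sum>u\<in>U. c u *\<^sub>R u) = a / 2 * ((\<Sum>u\<in>U. (c u)\<^sup>2) + (\<Sum>u\<in>U. c u)\<^sup>2)"
proof -
  \<comment> \<open>Off the diagonal this is \<open>q u + q v - q (u - v) = a + a - a\<close>; on
    it, \<open>2 * q u\<close>.\<close>
  have pol: "polar q u v = a + (if u = v then a else 0)" if "u \<in> U" "v \<in> U" for u v
    using quadratic_form_polar_self[OF q, of u] quadratic_form_diff[OF q, of u v]
      vertex[of u] vertex[of v] edge[of u v] that by auto
  have "2 * q (\<Sum>u\<in>U. c u *\<^sub>R u) = (\<Sum>u\<in>U. \<Sum>v\<in>U. c u * c v * polar q u v)"
    using bilinear_sum_same[of "polar q" c U] q
    by (simp add: quadratic_form_polar_self[OF q] quadratic_form_def)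
  also have "\<dots> = (\<Sum>u\<in>U. \<Sum>v\<in>U. a * (c u * c v) + (if u = v then a * (c u)\<^sup>2 else 0))"
    by (intro sum.cong refl) (auto simp: pol algebra_simps power2_eq_square)
  also have "\<dots> = (\<Sum>u\<in>U. \<Sum>v\<in>U. a * (c u * c v)) + (\<Sum>u\<in>U. a * (c u)\<^sup>2)"
    using \<open>finite U\<close> by (simp add: sum.distrib)
  also have "\<dots> = a * (\<Sum>u\<in>U. c u)\<^sup>2 + a * (\<Sum>u\<in>U. (c u)\<^sup>2)"
    by (simp add: power2_eq_square flip: sum_distrib_left sum_distrib_right)
  finally show ?thesis by (simp add: algebra_simps)
qed

section \<open>Upper bound by counting dimensions\<close>

lemma diagonalization_subset:
  assumes "diagonalization q B d" "N \<subseteq> B"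
  shows "q (\<Sum>b\<in>N. c b *\<^sub>R b) = (\<Sum>b\<in>N. d b * (c b)\<^sup>2)"
proof -
  define x where "x b = (if b \<in> N then c b else 0)" for b
  have "finite B" using assms unfolding diagonalization_def by blast
  have "(\<Sum>b\<in>B. x b *\<^sub>R b) = (\<Sum>b\<in>N. c b *\<^sub>R b)"
    by (rule sum.mono_neutral_cong_right) (use assms \<open>finite B\<close> in \<open>auto simp: x_def\<close>)
  moreover have "(\<Sum>b\<in>B. d b * (x b)\<^sup>2) = (\<Sum>b\<in>N. d b * (c b)\<^sup>2)"
    by (rule sum.mono_neutral_cong_right) (use assms \<open>finite B\<close> in \<open>auto simp: x_def\<close>)
  ultimately show ?thesis
    using assms(1) unfolding diagonalization_def by metis
qed

lemma card_positive_simplex_le: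
  assumes q: "quadratic_form q" and diag: "diagonalization q B d" and "a > 0" and "finite U"
    and vertex: "\<And>u. u \<in> U \<Longrightarrow> q u = a"
    and edge: "\<And>u v. u \<in> U \<Longrightarrow> v \<in> U \<Longrightarrow> u \<noteq> v \<Longrightarrow> q (u - v) = a"
  shows "card U \<le> card {b \<in> B. d b > 0}"
proof -
  \<comment> \<open>Zero entries are put into \<open>N\<close> too, so that exactly the positive
    ones remain outside it.\<close>
  define N where "N = {b \<in> B. d b \<le> 0}"
  have B: "finite B" "independent B" "span B = UNIV"
    using diag unfolding diagonalization_def by blast+
  have N: "N \<subseteq> B" "finite N"
    using B(1) by (auto simp: N_def)
  have indep_N: "independent N" by (rule independent_mono[OF B(2) N(1)])
  have qN: "q (\<Sum>b\<in>N. c b *\<^sub>R b) \<le> 0" for c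
    unfolding diagonalization_subset[OF diag N(1)]
    by (rule sum_nonpos) (auto simp: N_def mult_nonpos_nonneg)
  \<comment> \<open>Disjointness lets the cardinalities add up. A common vector \<open>u\<close>
    would have \<open>q u = a > 0\<close>, yet indicator coefficients exhibit it as a combination
    over \<open>N\<close>, where \<open>q\<close> is at most 0.\<close>
  have disj: "U \<inter> N = {}"
  proof (rule ccontr)
    assume "U \<inter> N \<noteq> {}"
    then obtain u where u: "u \<in> U" "u \<in> N" by blast
    have "(\<Sum>b\<in>N. (if b = u then 1 else 0) *\<^sub>R b) = (\<Sum>b\<in>N. if b = u then b else 0)"
      by (rule sum.cong) auto
    also have "\<dots> = u" using u N(2) by simp
    finally have "q u \<le> 0" using qN[of "\<lambda>b. if b = u then 1 else 0"] by simp
    then show False using vertex[OF u(1)] \<open>a > 0\<close> by simp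
  qed
  have "independent (U \<union> N)"
  proof (rule independent_if_scalars_zero)
    show "finite (U \<union> N)" using \<open>finite U\<close> N(2) by blast
  next
    fix c x
    assume sum0: "(\<Sum>x\<in>U \<union> N. c x *\<^sub>R x) = 0" and x: "x \<in> U \<union> N"
    have split: "(\<Sum>u\<in>U. c u *\<^sub>R u) + (\<Sum>b\<in>N. c b *\<^sub>R b) = 0"
      using sum0 by (simp add: sum.union_disjoint[OF \<open>finite U\<close> N(2) disj])
    then have "(\<Sum>u\<in>U. c u *\<^sub>R u) = - (\<Sum>b\<in>N. c b *\<^sub>R b)"
      by (rule eq_neg_iff_add_eq_0[THEN iffD2])
    \<comment> \<open>The two parts of the relation are opposite vectors, hence have the same value
      under the even form \<open>q\<close>; the simplex formula then forces the coefficients on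
      \<open>U\<close> to vanish, leaving a relation on \<open>N\<close> alone.\<close>
    then have "q (\<Sum>u\<in>U. c u *\<^sub>R u) \<le> 0"
      using qN[of c] quadratic_form_minus[OF q] by simp
    then have "(\<Sum>u\<in>U. (c u)\<^sup>2) + (\<Sum>u\<in>U. c u)\<^sup>2 \<le> 0"
      using quadratic_form_simplex[OF q \<open>finite U\<close> vertex edge, of c] \<open>a > 0\<close>
      by (simp add: mult_le_0_iff)
    moreover have "(\<Sum>u\<in>U. (c u)\<^sup>2) \<ge> 0" by (simp add: sum_nonneg)
    ultimately have "(\<Sum>u\<in>U. (c u)\<^sup>2) = 0"
      using zero_le_power2[of "\<Sum>u\<in>U. c u"] by linarith
    then have cU: "c u = 0" if "u \<in> U" for u
      using that \<open>finite U\<close> by (simp add: sum_nonneg_eq_0_iff)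
    then have "(\<Sum>b\<in>N. c b *\<^sub>R b) = 0" using split by simp
    then have "c b = 0" if "b \<in> N" for b
      using independentD[OF indep_N N(2) subset_refl] that by blast
    then show "c x = 0" using x cU by blast
  qed
  then have "card (U \<union> N) \<le> card B"
    using independent_span_bound[OF B(1)] B(3) by auto
  moreover have "card (U \<union> N) = card U + card N"
    using card_Un_disjoint[OF \<open>finite U\<close> N(2) disj] .
  moreover have "card B = card {b \<in> B. d b > 0} + card N"
    unfolding N_def using B(1)
    by (subst card_Un_disjoint[symmetric]) (auto intro!: arg_cong[where f = card])
  ultimately show ?thesis by linarith
qed

lemma clique_card_le:
  assumes q: "quadratic_form q" and diag: "diagonalization q B d" and "a > 0"
    and "finite K" "clique K (form_graph_edges q a)"
  shows "card K \<le> card {b \<in> B. d b > 0} + 1"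
proof (cases "K = {}")
  case False
  then obtain x0 where x0: "x0 \<in> K" by blast
  \<comment> \<open>The base vertex goes to 0 and is left out of \<open>U\<close>; it accounts for
    the \<open>+ 1\<close> in the bound.\<close>
  define U where "U = (\<lambda>x. x - x0) ` (K - {x0})"
  have K: "q (x - y) = a" if "x \<in> K" "y \<in> K" "x \<noteq> y" for x y
    using assms(5) that unfolding clique_form_graph_iff[OF q] by blast
  have "card U \<le> card {b \<in> B. d b > 0}"
  proof (rule card_positive_simplex_le[OF q diag \<open>a > 0\<close>])
    show "finite U" using \<open>finite K\<close> by (simp add: U_def)
    show "q u = a" if "u \<in> U" for u
      using that K x0 by (auto simp: U_def)
    show "q (u - v) = a" if "u \<in> U" "v \<in> U" "u \<noteq> v" for u v
      using that K by (auto simp: U_def)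
  qed
  moreover have "card U = card K - 1"
    unfolding U_def using \<open>finite K\<close> x0 by (subst card_image) (auto simp: inj_on_def)
  ultimately show ?thesis by linarith
qed simp

section \<open>Lower bound by a regular simplex\<close>

lemma exists_clique:
  assumes q: "quadratic_form q" and diag: "diagonalization q B d" and "a > 0"
  shows "\<exists>K. finite K \<and> clique K (form_graph_edges q a) \<and> card K = card {b \<in> B. d b > 0} + 1"
proof -
  define P where "P = {b \<in> B. d b > 0}"
  define r where "r = card P"
  \<comment> \<open>This scale gives \<open>q (e b) = d b * (s b)\<^sup>2 = a / 2\<close> for
    \<open>b\<close> in \<open>P\<close>.\<close>
  define s where "s b = sqrt (a / (2 * d b))" for b
  (* t solves (t - 1)^2 + (r - 1) * t^2 = 2; for r = 0 its junk value is harmless, as z = 0. *)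
  define t where "t = (1 + sqrt (1 + real r)) / real r"
  define e where "e b = s b *\<^sub>R b" for b
  define z where "z = (\<Sum>b\<in>P. t *\<^sub>R e b)"
  have P: "P \<subseteq> B" "finite P"
    using diag unfolding diagonalization_def P_def by auto
  \<comment> \<open>In the coordinates given by \<open>e\<close>, the form is \<open>a / 2\<close>
    times the squared Euclidean norm, so adjacency means squared distance 2.\<close>
  have qe: "q (\<Sum>b\<in>P. x b *\<^sub>R e b) = a / 2 * (\<Sum>b\<in>P. (x b)\<^sup>2)" for x
  proof -
    have "q (\<Sum>b\<in>P. x b *\<^sub>R e b) = (\<Sum>b\<in>P. d b * (x b * s b)\<^sup>2)"
      using diagonalization_subset[OF diag P(1), of "\<lambda>b. x b * s b"] by (simp add: e_def)
    also have "\<dots> = (\<Sum>b\<in>P. a / 2 * (x b)\<^sup>2)"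
      using \<open>a > 0\<close> by (intro sum.cong refl) (auto simp: P_def s_def power_mult_distrib)
    finally show ?thesis by (simp add: sum_distrib_left)
  qed
  have unit: "(\<Sum>b\<in>P. (if b = p then 1 else 0) *\<^sub>R e b) = e p" if "p \<in> P" for p
  proof -
    have "(\<Sum>b\<in>P. (if b = p then 1 else 0) *\<^sub>R e b) = (\<Sum>b\<in>P. if b = p then e b else 0)"
      by (rule sum.cong) auto
    then show ?thesis using that P(2) by simp
  qed
  have edge: "q (e p - e p') = a" if "p \<in> P" "p' \<in> P" "p \<noteq> p'" for p p'
  proof -
    have "e p - e p' = (\<Sum>b\<in>P. ((if b = p then 1 else 0) - (if b = p' then 1 else 0)) *\<^sub>R e b)"
      by (simp only: scaleR_left_diff_distrib sum_subtractf unit[OF that(1)] unit[OF that(2)])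
    then have "q (e p - e p')
        = a / 2 * (\<Sum>b\<in>P. ((if b = p then 1 else 0) - (if b = p' then 1 else 0))\<^sup>2)"
      by (simp only: qe)
    \<comment> \<open>The cross term vanishes because \<open>p\<close> and \<open>p'\<close>
      differ.\<close>
    also have "(\<Sum>b\<in>P. ((if b = p then 1 else 0) - (if b = p' then 1 else 0 :: real))\<^sup>2)
        = (\<Sum>b\<in>P. (if b = p then 1 else 0) + (if b = p' then 1 else 0))"
      using that(3) by (intro sum.cong) auto
    also have "\<dots> = 2" using that P(2) by (simp add: sum.distrib)
    finally show ?thesis by simp
  qed
  have apex: "q (z - e p) = a" if "p \<in> P" for p
  proof -
    have "r > 0" using that P(2) unfolding r_def by (auto simp: card_gt_0_iff)
    \<comment> \<open>This is the quadratic equation for \<open>t\<close> with its square completed;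
      expanding and cancelling \<open>r\<close> recovers \<open>root\<close>.\<close>
    then have "(real r * t - 1)\<^sup>2 = 1 + real r" by (simp add: t_def)
    then have "real r * (real r * t\<^sup>2 - 2 * t - 1) = 0"
      by (simp add: power2_eq_square algebra_simps)
    then have root: "real r * t\<^sup>2 - 2 * t = 1" using \<open>r > 0\<close> by simp
    have "z - e p = (\<Sum>b\<in>P. (t - (if b = p then 1 else 0)) *\<^sub>R e b)"
      unfolding z_def by (simp only: scaleR_left_diff_distrib sum_subtractf unit[OF that])
    then have "q (z - e p) = a / 2 * (\<Sum>b\<in>P. (t - (if b = p then 1 else 0))\<^sup>2)"
      by (simp only: qe)
    also have "(\<Sum>b\<in>P. (t - (if b = p then 1 else 0))\<^sup>2)
        = (\<Sum>b\<in>P. t\<^sup>2 + (if b = p then 1 - 2 * t else 0))"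
      by (intro sum.cong) (auto simp: power2_eq_square algebra_simps)
    also have "\<dots> = 2" using that P(2) root by (simp add: sum.distrib r_def)
    finally show ?thesis by simp
  qed
  have apex': "q (e p - z) = a" if "p \<in> P" for p
    using apex[OF that] quadratic_form_diff_commute[OF q, of z "e p"] by simp
  have "q 0 = 0" by (rule quadratic_form_zero[OF q])
  \<comment> \<open>Coinciding vertices would have difference 0 and so give
    \<open>a = q 0 = 0\<close>; the same argument separates \<open>z\<close> from the image of
    \<open>e\<close>.\<close>
  have inj: "inj_on e P"
    using edge \<open>q 0 = 0\<close> \<open>a > 0\<close> by (intro inj_onI) (metis diff_self less_irrefl)
  have "z \<notin> e ` P"
    using apex \<open>q 0 = 0\<close> \<open>a > 0\<close> by (metis diff_self imageE less_irrefl)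
  then have "card (insert z (e ` P)) = card P + 1"
    using P(2) by (simp add: card_image[OF inj])
  moreover have "clique (insert z (e ` P)) (form_graph_edges q a)"
    unfolding clique_form_graph_iff[OF q]
    using edge apex apex' by auto
  moreover have "finite (insert z (e ` P))" using P(2) by simp
  ultimately show ?thesis unfolding P_def by meson
qed

section \<open>The clique number for either sign of \<open>a\<close>\<close>

lemma clique_number_positive:
  assumes "quadratic_form q" "diagonalization q B d" "a > 0"
  shows "clique_number UNIV (form_graph_edges q a) = enat (card {b \<in> B. d b > 0} + 1)"
proof (rule antisym)
  show "clique_number UNIV (form_graph_edges q a) \<le> enat (card {b \<in> B. d b > 0} + 1)"
    unfolding clique_number_def
    by (rule SUP_least) (use clique_card_le[OF assms] in auto)
next
  obtain K where "finite K" "clique K (form_graph_edges q a)"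
    and card: "card K = card {b \<in> B. d b > 0} + 1"
    using exists_clique[OF assms] by blast
  then show "enat (card {b \<in> B. d b > 0} + 1) \<le> clique_number UNIV (form_graph_edges q a)"
    unfolding clique_number_def card[symmetric] by (intro SUP_upper) auto
qed

lemma quadratic_form_uminus:
  assumes "quadratic_form q"
  shows "quadratic_form (\<lambda>x. - q x)"
proof -
  have "polar (\<lambda>x. - q x) = (\<lambda>x y. - polar q x y)"
    by (simp add: polar_def fun_eq_iff)
  then show ?thesis
    using assms unfolding quadratic_form_def bilinear_def
    by (simp add: linear_compose_neg)
qed

lemma diagonalization_uminus:
  "diagonalization q B d \<Longrightarrow> diagonalization (\<lambda>x. - q x) B (\<lambda>b. - d b)"
  unfolding diagonalization_def by (simp add: sum_negf)

theorem theorem5p6: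
  fixes q :: "'v::real_vector \<Rightarrow> real" and a :: real and r_plus r_minus :: nat
  assumes "finite_dimensional TYPE('v)"
    and "quadratic_form q"
    and "nondegenerate q"
    and "has_signature q (r_plus, r_minus)"
    and "a \<noteq> 0"
  shows "clique_number (UNIV :: 'v set) (form_graph_edges q a) =
    (if a > 0 then enat (r_plus + 1) else enat (r_minus + 1))"
proof -
  obtain B d where diag: "diagonalization q B d"
    and r: "r_plus = card {b \<in> B. d b > 0}" "r_minus = card {b \<in> B. d b < 0}"
    using assms(4) unfolding has_signature_def by auto
  show ?thesis
  proof (cases "a > 0")
    case True
    then show ?thesis using clique_number_positive[OF assms(2) diag] r by simp
  next
    case False
    then have "- a > 0" using \<open>a \<noteq> 0\<close> by simp
    \<comment> \<open>Negating both the form and the value keeps the graph, while the positive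
      entries of the negated diagonalization are the negative entries of the original, which
      \<open>r_minus\<close> counts.\<close>
    have "form_graph_edges q a = form_graph_edges (\<lambda>x. - q x) (- a)"
      by (simp add: form_graph_edges_def)
    then show ?thesis
      using clique_number_positive[OF quadratic_form_uminus[OF assms(2)]
          diagonalization_uminus[OF diag] \<open>- a > 0\<close>] r False by simp
  qed
qed

end
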